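(* Let $A\colon\mathcal{T}\to L_2(P_0)$ be the score operator of the model, let $\dot\psi\colon\mathcal{T}\to\mathbb{R}$ be the gradient of $\psi$ at $\lambda_0$, and let $\mathcal{I}$ be the semiparametric Fisher information for $\beta_0=\psi(\lambda_0)$. Then $\mathcal{I}>0$ if and only if $\dot\psi\in\mathcal{R}(A^* )$.
   Context: Setting. $(V,\|\cdot\|)$ is a (real) normed vector space, $\Lambda\subseteq V$, and $\mathcal{P}=\{P_\lambda:\lambda\in\Lambda\}$ is a collection of probability distributions on a measurable space $(\mathcal{X},\mathcal{B})$, dominated by a $\sigma$-finite measure $\mu$. Write $p_\lambda=dP_\lambda/d\mu$. There is $\lambda_0\in\Lambda$ with $P_0=P_{\lambda_0}$ the true distribution, and $p_0=p_{\lambda_0}$. $L_2(P_0)$ is the space of (classes of) real functions with $\|f\|_2=(\int f^2\,dP_0)^{1/2}<\infty$. Consider paths $t\mapsto\lambda_t\in\Lambda$, $t\in(0,\varepsilon)$, $\varepsilon>0$, such that $t^{-1}(\lambda_t-\lambda_0)\to\alpha\in V$ as $t\downarrow0$ (regular paths). The set of all limits $\alpha$ obtained in this way is the tangent space $\mathcal{T}$, assumed to be a closed linear subspace of $V$ (with the norm of $V$). Mean-square differentiability: there is a continuous linear operator $A\colon\mathcal{T}\to L_2(P_0)$ (the score operator) such that, for every regular path with limit $\alpha$, $\int\left(\frac{\sqrt{p_{\lambda_t}}-\sqrt{p_0}}{t}-\frac12 (A\alpha)\sqrt{p_0}\right)^2d\mu\to0$ as $t\downarrow0$. Pathwise differentiability: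 $\psi\colon\Lambda\to\mathbb{R}$ is a functional for which there is a continuous linear $\dot\psi\colon\mathcal{T}\to\mathbb{R}$ (the gradient) with $t^{-1}(\psi(\lambda_t)-\psi(\lambda_0))\to\dot\psi\alpha$ as $t\downarrow0$ for every regular path with limit $\alpha$. The parameter of interest is $\beta_0=\psi(\lambda_0)$. Semiparametric Fisher information: $\mathcal{I}=\inf_{\alpha}\|A\alpha\|_2^2/|\dot\psi\alpha|^2$, the infimum being over $\alpha\in\mathcal{T}$ with $\dot\psi\alpha\neq0$ (infimum of the empty set is $+\infty$). Notation: $V^*$ denotes the space of continuous linear functionals on a normed space $V$; the adjoint $A^*\colon L_2(P_0)^*\to\mathcal{T}^*$ is defined by $(A^*w^* )(\alpha)=w^*(A\alpha)$; $\mathcal{R}(A^* )\subseteq\mathcal{T}^*$ denotes its range. *)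

theory Defs
  imports "HOL-Probability.Probability"
begin

section \<open>The space of square-integrable functions and its dual\<close>

text \<open>
  Elements of \<open>L\<^sub>2(M)\<close> are handled through representatives: measurable functions with
  integrable square, \<open>l2_norm\<close> being a seminorm that vanishes exactly on the functions that
  are almost everywhere zero. Identities between classes become identities almost everywhere.
\<close>

definition L2 :: "'x measure \<Rightarrow> ('x \<Rightarrow> real) set" where
  "L2 M = {f \<in> borel_measurable M. integrable M (\<lambda>x. (f x)\<^sup>2)}"

definition l2_norm :: "'x measure \<Rightarrow> ('x \<Rightarrow> real) \<Rightarrow> real" where
  "l2_norm M f = sqrt (\<integral>x. (f x)\<^sup>2 \<partial>M)"

text \<open>
  Functionals with domain a set \<open>S\<close> are represented by functions that are \<open>undefined\<close>
  outside \<open>S\<close>, so that equality of functions is equality of functionals on \<open>S\<close>.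
  Continuity with respect to \<open>l2_norm\<close> forces a functional on \<open>L2 M\<close> to respect almost
  everywhere equality (see \<open>L2_dual_AE_cong\<close> below), hence \<open>L2_dual M\<close> is the dual of the
  space of classes.
\<close>

definition L2_dual :: "'x measure \<Rightarrow> (('x \<Rightarrow> real) \<Rightarrow> real) set" where
  "L2_dual M = {w \<in> extensional (L2 M).
     (\<forall>f\<in>L2 M. \<forall>g\<in>L2 M. w (\<lambda>x. f x + g x) = w f + w g) \<and>
     (\<forall>c. \<forall>f\<in>L2 M. w (\<lambda>x. c * f x) = c * w f) \<and>
     (\<forall>f\<in>L2 M. \<forall>e>0. \<exists>d>0. \<forall>g\<in>L2 M. l2_norm M (\<lambda>x. g x - f x) < d \<longrightarrow> \<bar>w g - w f\<bar> < e)}"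

lemma L2_dual_AE_cong:
  assumes w: "w \<in> L2_dual M" and f: "f \<in> L2 M" and g: "g \<in> L2 M" and eq: "AE x in M. f x = g x"
  shows "w f = w g"
proof (rule ccontr)
  assume "w f \<noteq> w g"
  then have "0 < \<bar>w g - w f\<bar>" by simp
  then obtain d where d: "d > 0"
    "\<And>h. h \<in> L2 M \<Longrightarrow> l2_norm M (\<lambda>x. h x - f x) < d \<Longrightarrow> \<bar>w h - w f\<bar> < \<bar>w g - w f\<bar>"
    using w f unfolding L2_dual_def by blast
  have "(\<integral>x. (g x - f x)\<^sup>2 \<partial>M) = 0"
    using eq by (intro integral_eq_zero_AE) auto
  then have "l2_norm M (\<lambda>x. g x - f x) < d"
    using d(1) by (simp add: l2_norm_def)
  from d(2)[OF g this] show False by simp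
qed

definition subspace_dual :: "'v::real_normed_vector set \<Rightarrow> ('v \<Rightarrow> real) set" where
  "subspace_dual S = {v \<in> extensional S.
     (\<forall>a\<in>S. \<forall>b\<in>S. v (a + b) = v a + v b) \<and>
     (\<forall>c. \<forall>a\<in>S. v (c *\<^sub>R a) = c * v a) \<and>
     continuous_on S v}"

definition continuous_linear_into_L2 ::
    "'v::real_normed_vector set \<Rightarrow> 'x measure \<Rightarrow> ('v \<Rightarrow> 'x \<Rightarrow> real) \<Rightarrow> bool" where
  "continuous_linear_into_L2 S M A \<longleftrightarrow>
     (\<forall>a\<in>S. A a \<in> L2 M) \<and>
     (\<forall>a\<in>S. \<forall>b\<in>S. AE x in M. A (a + b) x = A a x + A b x) \<and>
     (\<forall>c. \<forall>a\<in>S. AE x in M. A (c *\<^sub>R a) x = c * A a x) \<and>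
     (\<forall>a\<in>S. ((\<lambda>b. l2_norm M (\<lambda>x. A b x - A a x)) \<longlongrightarrow> 0) (at a within S))"

definition adjoint_op ::
    "'v set \<Rightarrow> ('v \<Rightarrow> 'x \<Rightarrow> real) \<Rightarrow> (('x \<Rightarrow> real) \<Rightarrow> real) \<Rightarrow> 'v \<Rightarrow> real" where
  "adjoint_op S A w = restrict (\<lambda>a. w (A a)) S"


section \<open>Regular paths and differentiability\<close>

definition regular_path ::
    "'v::real_normed_vector set \<Rightarrow> 'v \<Rightarrow> (real \<Rightarrow> 'v) \<Rightarrow> 'v \<Rightarrow> bool" where
  "regular_path \<Lambda> l0 l a \<longleftrightarrow>
     (\<exists>\<epsilon>>0. \<forall>t\<in>{0<..<\<epsilon>}. l t \<in> \<Lambda>) \<and>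
     ((\<lambda>t. (l t - l0) /\<^sub>R t) \<longlongrightarrow> a) (at_right 0)"

definition tangent_space :: "'v::real_normed_vector set \<Rightarrow> 'v \<Rightarrow> 'v set" where
  "tangent_space \<Lambda> l0 = {a. \<exists>l. regular_path \<Lambda> l0 l a}"

definition dominated_model :: "'x measure \<Rightarrow> 'v set \<Rightarrow> ('v \<Rightarrow> 'x measure) \<Rightarrow> bool" where
  "dominated_model \<mu> \<Lambda> P \<longleftrightarrow>
     sigma_finite_measure \<mu> \<and>
     (\<forall>l\<in>\<Lambda>. prob_space (P l) \<and> sets (P l) = sets \<mu> \<and> absolutely_continuous \<mu> (P l))"

definition dens :: "'x measure \<Rightarrow> ('v \<Rightarrow> 'x measure) \<Rightarrow> 'v \<Rightarrow> 'x \<Rightarrow> real" where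
  "dens \<mu> P l x = enn2real (RN_deriv \<mu> (P l) x)"

text \<open>
  The mean-square remainder is a nonnegative Lebesgue integral, so no convention about
  integrals of non-integrable functions is involved.
\<close>

definition score_operator ::
    "'x measure \<Rightarrow> 'v::real_normed_vector set \<Rightarrow> ('v \<Rightarrow> 'x measure) \<Rightarrow> 'v \<Rightarrow>
      ('v \<Rightarrow> 'x \<Rightarrow> real) \<Rightarrow> bool" where
  "score_operator \<mu> \<Lambda> P l0 A \<longleftrightarrow>
     continuous_linear_into_L2 (tangent_space \<Lambda> l0) (P l0) A \<and>
     (\<forall>l a. regular_path \<Lambda> l0 l a \<longrightarrow>
       ((\<lambda>t. \<integral>\<^sup>+x. ennreal (((sqrt (dens \<mu> P (l t) x) - sqrt (dens \<mu> P l0 x)) / t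
                 - 1/2 * A a x * sqrt (dens \<mu> P l0 x))\<^sup>2) \<partial>\<mu>) \<longlongrightarrow> 0) (at_right 0))"

definition path_gradient ::
    "'v::real_normed_vector set \<Rightarrow> 'v \<Rightarrow> ('v \<Rightarrow> real) \<Rightarrow> ('v \<Rightarrow> real) \<Rightarrow> bool" where
  "path_gradient \<Lambda> l0 \<psi> d\<psi> \<longleftrightarrow>
     d\<psi> \<in> subspace_dual (tangent_space \<Lambda> l0) \<and>
     (\<forall>l a. regular_path \<Lambda> l0 l a \<longrightarrow>
       ((\<lambda>t. (\<psi> (l t) - \<psi> l0) / t) \<longlongrightarrow> d\<psi> a) (at_right 0))"

text \<open>In \<open>ereal\<close> the infimum of the empty set is \<open>\<infinity>\<close>.\<close>

definition fisher_information ::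
    "'v::real_normed_vector set \<Rightarrow> 'x measure \<Rightarrow> ('v \<Rightarrow> 'x \<Rightarrow> real) \<Rightarrow> ('v \<Rightarrow> real) \<Rightarrow> ereal" where
  "fisher_information T P0 A d\<psi> =
     (INF a\<in>{a \<in> T. d\<psi> a \<noteq> 0}. ereal ((l2_norm P0 (A a))\<^sup>2 / \<bar>d\<psi> a\<bar>\<^sup>2))"

end

theory Submission
  imports Defs
begin

text \<open>
  Positivity of the information says \<open>c (d\<psi> a)\<^sup>2 \<le> \<parallel>A a\<parallel>\<^sup>2\<close> for some \<open>c > 0\<close>. Then the functional
  \<open>J a = \<parallel>A a\<parallel>\<^sup>2 - 2 d\<psi> a\<close> is bounded below on the tangent space. By the parallelogram law the scores
  \<open>A a\<^sub>n\<close> of a minimizing sequence are Cauchy, and perturbing \<open>a\<^sub>n\<close> in a direction \<open>h\<close> shows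
  \<open>\<langle>A a\<^sub>n, A h\<rangle> \<longlongrightarrow> d\<psi> h\<close>. Hence \<open>w g = lim \<langle>A a\<^sub>n, g\<rangle>\<close> is a continuous functional with \<open>A\<^sup>* w = d\<psi>\<close>;
  neither completeness of \<open>L\<^sub>2\<close> nor the Hahn-Banach theorem is needed. Conversely, continuity of \<open>w\<close>
  at \<open>0\<close> bounds \<open>\<parallel>A a\<parallel> / \<bar>w (A a)\<bar>\<close> away from \<open>0\<close>.
\<close>

text \<open>Evaluating at the minimizer \<open>s = - d / b\<close> gives the bound; for
  \<open>b = 0\<close> the expression is affine in \<open>s\<close>, so nonnegativity forces
  \<open>d = 0\<close>. It serves both Cauchy-Schwarz and the estimate for approximate
  minimizers.\<close>

lemma quadratic_nonneg_imp_discriminant: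
  fixes b c d :: real
  assumes "b \<ge> 0" and nonneg: "\<And>s. 0 \<le> c + 2 * s * d + s\<^sup>2 * b"
  shows "d\<^sup>2 \<le> b * c"
proof (cases "b = 0")
  case True
  have "d = 0"
  proof (rule ccontr)
    assume "d \<noteq> 0"
    \<comment> \<open>With \<open>b = 0\<close> this choice of \<open>s\<close> gives the value
      -1.\<close>
    with nonneg[of "- (c + 1) / (2 * d)"] True show False by (simp add: field_simps)
  qed
  with True show ?thesis by simp
next
  case False
  with \<open>b \<ge> 0\<close> have b: "b > 0" by simp
  have "0 \<le> b * (c + 2 * (- d / b) * d + (- d / b)\<^sup>2 * b)"
    using b nonneg[of "- d / b"] by simp
  also have "\<dots> = b * c - d\<^sup>2"
    using b by (simp add: field_simps power2_eq_square)
  finally show ?thesis by simp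
qed

section \<open>Inner product and seminorm on square-integrable representatives\<close>

definition l2_inner :: "'x measure \<Rightarrow> ('x \<Rightarrow> real) \<Rightarrow> ('x \<Rightarrow> real) \<Rightarrow> real" where
  "l2_inner M f g = (\<integral>x. f x * g x \<partial>M)"

lemma integrable_mult_L2:
  assumes "f \<in> L2 M" "g \<in> L2 M"
  shows "integrable M (\<lambda>x. f x * g x)"
proof (rule Bochner_Integration.integrable_bound)
  show "integrable M (\<lambda>x. (f x)\<^sup>2 + (g x)\<^sup>2)"
    using assms by (simp add: L2_def)
  have "\<bar>u * v\<bar> \<le> u\<^sup>2 + v\<^sup>2" for u v :: real
  proof -
    have "2 * \<bar>u * v\<bar> \<le> u\<^sup>2 + v\<^sup>2"
      using sum_squares_bound[of "\<bar>u\<bar>" "\<bar>v\<bar>"] by (simp add: abs_mult)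
    moreover have "0 \<le> \<bar>u * v\<bar>" by simp
    ultimately show ?thesis by linarith
  qed
  then show "AE x in M. norm (f x * g x) \<le> norm ((f x)\<^sup>2 + (g x)\<^sup>2)"
    by simp
qed (use assms in \<open>auto simp: L2_def\<close>)

lemma L2_scale: "f \<in> L2 M \<Longrightarrow> (\<lambda>x. c * f x) \<in> L2 M"
  by (auto simp: L2_def power_mult_distrib)

lemma L2_add:
  assumes "f \<in> L2 M" "g \<in> L2 M"
  shows "(\<lambda>x. f x + g x) \<in> L2 M"
  using assms integrable_mult_L2[OF assms]
  by (auto simp: L2_def power2_sum mult.assoc)

lemma L2_diff:
  assumes "f \<in> L2 M" "g \<in> L2 M"
  shows "(\<lambda>x. f x - g x) \<in> L2 M"
  using L2_add[OF assms(1) L2_scale[OF assms(2), of "-1"]] by simp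

lemma l2_inner_add_right:
  assumes "f \<in> L2 M" "g \<in> L2 M" "h \<in> L2 M"
  shows "l2_inner M f (\<lambda>x. g x + h x) = l2_inner M f g + l2_inner M f h"
  using assms by (simp add: l2_inner_def distrib_left integrable_mult_L2)

lemma l2_inner_scale_right: "l2_inner M f (\<lambda>x. c * g x) = c * l2_inner M f g"
  by (simp add: l2_inner_def mult.left_commute[of _ c])

lemma l2_inner_diff_left:
  assumes "f \<in> L2 M" "g \<in> L2 M" "h \<in> L2 M"
  shows "l2_inner M (\<lambda>x. f x - g x) h = l2_inner M f h - l2_inner M g h"
  using assms by (simp add: l2_inner_def left_diff_distrib integrable_mult_L2)

lemma l2_norm_nonneg [simp]: "0 \<le> l2_norm M f"
  by (simp add: l2_norm_def)

lemma l2_norm_power2: "(l2_norm M f)\<^sup>2 = (\<integral>x. (f x)\<^sup>2 \<partial>M)"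
  by (simp add: l2_norm_def)

lemma l2_norm_scale: "l2_norm M (\<lambda>x. c * f x) = \<bar>c\<bar> * l2_norm M f"
  by (simp add: l2_norm_def power_mult_distrib real_sqrt_mult)

text \<open>The score operator is linear only almost everywhere; this carries its linearity over to
  exact equalities of seminorms.\<close>

lemma l2_norm_cong_AE:
  assumes "f \<in> L2 M" "g \<in> L2 M" "AE x in M. f x = g x"
  shows "l2_norm M f = l2_norm M g"
proof -
  have "(\<integral>x. (f x)\<^sup>2 \<partial>M) = (\<integral>x. (g x)\<^sup>2 \<partial>M)"
    using assms by (intro integral_cong_AE) (auto simp: L2_def)
  then show ?thesis by (simp add: l2_norm_def)
qed

text \<open>Keeping \<open>s\<close> free lets one expansion yield Cauchy-Schwarz, the parallelogram
  law (from \<open>s = 1\<close> and \<open>s = -1\<close>) and the perturbation of a minimizing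
  sequence.\<close>

lemma l2_norm_add_scale_power2:
  assumes "f \<in> L2 M" "g \<in> L2 M"
  shows "(l2_norm M (\<lambda>x. f x + s * g x))\<^sup>2 =
    (l2_norm M f)\<^sup>2 + 2 * s * l2_inner M f g + s\<^sup>2 * (l2_norm M g)\<^sup>2"
proof -
  have "(f x + s * g x)\<^sup>2 = (f x)\<^sup>2 + 2 * s * (f x * g x) + s\<^sup>2 * (g x)\<^sup>2" for x
    by (simp add: power2_eq_square algebra_simps)
  then show ?thesis
    using assms integrable_mult_L2[OF assms]
    by (simp add: l2_norm_power2 l2_inner_def L2_def)
qed

lemma l2_Cauchy_Schwarz:
  assumes "f \<in> L2 M" "g \<in> L2 M"
  shows "\<bar>l2_inner M f g\<bar> \<le> l2_norm M f * l2_norm M g"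
proof -
  have "(l2_inner M f g)\<^sup>2 \<le> (l2_norm M g)\<^sup>2 * (l2_norm M f)\<^sup>2"
  proof (rule quadratic_nonneg_imp_discriminant)
    show "0 \<le> (l2_norm M f)\<^sup>2 + 2 * s * l2_inner M f g + s\<^sup>2 * (l2_norm M g)\<^sup>2" for s
      using l2_norm_add_scale_power2[OF assms, of s] zero_le_power2 by metis
  qed simp
  then have "\<bar>l2_inner M f g\<bar>\<^sup>2 \<le> (l2_norm M f * l2_norm M g)\<^sup>2"
    by (simp add: power_mult_distrib mult.commute)
  then show ?thesis
    by (rule power2_le_imp_le) simp
qed

lemma l2_parallelogram:
  assumes "f \<in> L2 M" "g \<in> L2 M"
  shows "(l2_norm M (\<lambda>x. f x - g x))\<^sup>2 =
    2 * (l2_norm M f)\<^sup>2 + 2 * (l2_norm M g)\<^sup>2 - (l2_norm M (\<lambda>x. f x + g x))\<^sup>2"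
  using l2_norm_add_scale_power2[OF assms, of 1] l2_norm_add_scale_power2[OF assms, of "-1"]
  by simp

section \<open>Continuity and boundedness of functionals\<close>

lemma L2_dualI:
  assumes add: "\<And>f g. f \<in> L2 M \<Longrightarrow> g \<in> L2 M \<Longrightarrow> w (\<lambda>x. f x + g x) = w f + w g"
    and scale: "\<And>c f. f \<in> L2 M \<Longrightarrow> w (\<lambda>x. c * f x) = c * w f"
    and bound: "\<And>f. f \<in> L2 M \<Longrightarrow> \<bar>w f\<bar> \<le> C * l2_norm M f"
  shows "restrict w (L2 M) \<in> L2_dual M"
proof -
  have "\<exists>d>0. \<forall>g\<in>L2 M. l2_norm M (\<lambda>x. g x - f x) < d \<longrightarrow> \<bar>w g - w f\<bar> < e"
    if f: "f \<in> L2 M" and e: "e > 0" for f e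
  \<comment> \<open>The denominator is \<open>\<bar>C\<bar> + 1\<close> because \<open>C\<close> may
    be zero or negative.\<close>
  proof (intro exI[of _ "e / (\<bar>C\<bar> + 1)"] conjI ballI impI)
    show "e / (\<bar>C\<bar> + 1) > 0" using e by simp
    fix g assume g: "g \<in> L2 M" and lt: "l2_norm M (\<lambda>x. g x - f x) < e / (\<bar>C\<bar> + 1)"
    have "w (\<lambda>x. g x - f x) = w g - w f"
      using add[OF g L2_scale[OF f, of "-1"]] scale[OF f, of "-1"] by simp
    then have "\<bar>w g - w f\<bar> \<le> C * l2_norm M (\<lambda>x. g x - f x)"
      using bound[OF L2_diff[OF g f]] by simp
    also have "\<dots> \<le> (\<bar>C\<bar> + 1) * l2_norm M (\<lambda>x. g x - f x)"
      by (intro mult_right_mono) auto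
    also have "\<dots> < e"
      using lt by (simp add: pos_less_divide_eq mult.commute add_pos_nonneg)
    finally show "\<bar>w g - w f\<bar> < e" .
  qed
  then show ?thesis
    using add scale by (simp add: L2_dual_def L2_add L2_scale)
qed

text \<open>Continuity at zero with tolerance 1 gives a ball of radius \<open>d\<close> on which
  \<open>w\<close> stays below 1 in absolute value. If \<open>w f\<close> is nonzero,
  \<open>f\<close> divided by \<open>w f\<close> is mapped to 1, hence lies outside that
  ball.\<close>

lemma L2_dual_bounded:
  assumes w: "w \<in> L2_dual M"
  obtains d where "d > 0" "\<And>f. f \<in> L2 M \<Longrightarrow> d * \<bar>w f\<bar> \<le> l2_norm M f"
proof -
  have zero: "(\<lambda>x. 0) \<in> L2 M" by (simp add: L2_def)
  have scale: "w (\<lambda>x. c * f x) = c * w f" if "f \<in> L2 M" for c f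
    using w that by (simp add: L2_dual_def)
  have w0: "w (\<lambda>x. 0) = 0"
    using scale[OF zero, of 0] by simp
  have "\<forall>f\<in>L2 M. \<forall>e>0. \<exists>d>0. \<forall>g\<in>L2 M. l2_norm M (\<lambda>x. g x - f x) < d \<longrightarrow> \<bar>w g - w f\<bar> < e"
    using w by (simp add: L2_dual_def)
  from this[rule_format, OF zero zero_less_one] obtain d
    where d: "d > 0" "\<And>g. g \<in> L2 M \<Longrightarrow> l2_norm M g < d \<Longrightarrow> \<bar>w g\<bar> < 1"
    by (auto simp: w0)
  have "d * \<bar>w f\<bar> \<le> l2_norm M f" if f: "f \<in> L2 M" for f
  proof (cases "w f = 0")
    case False
    have "w (\<lambda>x. (1 / w f) * f x) = 1"
      using scale[OF f, of "1 / w f"] False by simp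
    then have "d \<le> l2_norm M (\<lambda>x. (1 / w f) * f x)"
      using d(2)[OF L2_scale[OF f, of "1 / w f"]] by (cases "l2_norm M (\<lambda>x. 1 / w f * f x) < d") auto
    also have "\<dots> = l2_norm M f / \<bar>w f\<bar>"
      using l2_norm_scale[of M "1 / w f" f] by simp
    finally show ?thesis using False by (simp add: field_simps)
  qed simp
  with d(1) show thesis by (rule that)
qed

section \<open>Factoring a bounded functional through the score operator\<close>

lemma functional_factors_through_L2_dual:
  fixes T :: "'v::real_normed_vector set"
  assumes T: "subspace T"
    and A: "continuous_linear_into_L2 T M A"
    and \<phi>: "\<phi> \<in> subspace_dual T"
    and c: "c > 0" "\<And>a. a \<in> T \<Longrightarrow> c * (\<phi> a)\<^sup>2 \<le> (l2_norm M (A a))\<^sup>2"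
  obtains w where "w \<in> L2_dual M" "\<And>a. a \<in> T \<Longrightarrow> w (A a) = \<phi> a"
proof -
  have AL: "A a \<in> L2 M" if "a \<in> T" for a
    using A that by (simp add: continuous_linear_into_L2_def)
  have T_comb: "a + s *\<^sub>R b \<in> T" if "a \<in> T" "b \<in> T" for a b s
    using T that by (simp add: subspace_add subspace_scale)
  have \<phi>_comb: "\<phi> (a + s *\<^sub>R b) = \<phi> a + s * \<phi> b" if "a \<in> T" "b \<in> T" for a b s
    using \<phi> that T by (simp add: subspace_dual_def subspace_scale)
  have A_comb: "AE x in M. A (a + s *\<^sub>R b) x = A a x + s * A b x" if "a \<in> T" "b \<in> T" for a b s
  proof -
    have "AE x in M. A (a + s *\<^sub>R b) x = A a x + A (s *\<^sub>R b) x"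
      "AE x in M. A (s *\<^sub>R b) x = s * A b x"
      using A that T by (simp_all add: continuous_linear_into_L2_def subspace_scale)
    then show ?thesis by eventually_elim simp
  qed
  have norm_comb: "l2_norm M (A (a + s *\<^sub>R b)) = l2_norm M (\<lambda>x. A a x + s * A b x)"
    if "a \<in> T" "b \<in> T" for a b s
    using that by (intro l2_norm_cong_AE A_comb AL L2_add L2_scale T_comb)
  \<comment> \<open>The factor 2 makes the first variation of \<open>J\<close> at \<open>a\<close>
    in direction \<open>h\<close> twice the inner product of \<open>A a\<close> and
    \<open>A h\<close> minus \<open>\<phi> h\<close>, so near-minimizers nearly represent
    \<open>\<phi>\<close>.\<close>
  define J where "J a = (l2_norm M (A a))\<^sup>2 - 2 * \<phi> a" for a
  have J_lower: "- 1 / c \<le> J a" if a: "a \<in> T" for a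
  proof -
    have "0 \<le> (c * \<phi> a - 1)\<^sup>2" by simp
    also have "\<dots> = c * (c * (\<phi> a)\<^sup>2 - 2 * \<phi> a) + 1"
      by (simp add: power2_eq_square algebra_simps)
    also have "\<dots> \<le> c * J a + 1"
      using c a by (simp add: J_def)
    finally show ?thesis using c(1) by (simp add: field_simps)
  qed
  define m where "m = Inf (J ` T)"
  have bdd: "bdd_below (J ` T)"
    using J_lower by (intro bdd_belowI2)
  have m_le: "m \<le> J a" if "a \<in> T" for a
    unfolding m_def using bdd that by (rule cINF_lower)
  \<comment> \<open>Besides tending to 0, this sequence is decreasing, which the Cauchy argument
    uses, and starts at 1, which fixes the constant in the bound for \<open>w\<close>.\<close>
  define \<epsilon> where "\<epsilon> n = 1 / real (Suc n)" for n
  have \<epsilon>_lim: "\<epsilon> \<longlonglongrightarrow> 0"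
    unfolding \<epsilon>_def using LIMSEQ_inverse_real_of_nat by (simp add: inverse_eq_divide)
  have "\<exists>a. a \<in> T \<and> J a < m + \<epsilon> n" for n
  proof -
    have "J ` T \<noteq> {}" using subspace_0[OF T] by auto
    moreover have "Inf (J ` T) < m + \<epsilon> n" by (simp add: m_def \<epsilon>_def)
    ultimately obtain y where "y \<in> J ` T" "y < m + \<epsilon> n" by (rule cInf_lessD[THEN bexE])
    then show ?thesis by blast
  qed
  then have "\<exists>a. \<forall>n. a n \<in> T \<and> J (a n) < m + \<epsilon> n"
    by (intro choice allI)
  then obtain a where aT: "a n \<in> T" and Ja: "J (a n) < m + \<epsilon> n" for n
    by blast
  define u where "u n = A (a n)" for n
  have uL: "u n \<in> L2 M" for n
    unfolding u_def using aT by (rule AL)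

  have u_Cauchy: "(l2_norm M (\<lambda>x. u n x - u k x))\<^sup>2 \<le> 2 * (\<epsilon> n + \<epsilon> k)" for n k
  proof -
    \<comment> \<open>The midpoint \<open>b\<close> lies in \<open>T\<close>, so \<open>J b\<close>
      is at least \<open>m\<close>. The scalar 1 is written out so that the facts about
      \<open>a + s *\<^sub>R b\<close> apply.\<close>
    define b where "b = (1/2) *\<^sub>R (a n + 1 *\<^sub>R a k)"
    have bT: "b \<in> T" unfolding b_def by (intro subspace_scale T T_comb aT)
    have b2: "a n + 1 *\<^sub>R a k = b + 1 *\<^sub>R b"
      by (simp add: b_def flip: scaleR_add_left)
    then have \<phi>b: "2 * \<phi> b = \<phi> (a n) + \<phi> (a k)"
      using \<phi>_comb[OF aT aT, of n 1 k] \<phi>_comb[OF bT bT, of 1] by simp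
    from b2 have "l2_norm M (\<lambda>x. u n x + u k x) = l2_norm M (\<lambda>x. 2 * A b x)"
      using norm_comb[OF aT aT, of n 1 k] norm_comb[OF bT bT, of 1] by (simp add: u_def)
    then have sum: "(l2_norm M (\<lambda>x. u n x + u k x))\<^sup>2 = 4 * (l2_norm M (A b))\<^sup>2"
      by (simp add: l2_norm_scale power_mult_distrib)
    \<comment> \<open>In the parallelogram law the terms in \<open>\<phi>\<close> cancel because
      \<open>2 * \<phi> b\<close> is \<open>\<phi> (a n) + \<phi> (a k)\<close>.\<close>
    have "(l2_norm M (\<lambda>x. u n x - u k x))\<^sup>2 = 2 * J (a n) + 2 * J (a k) - 4 * J b"
      using l2_parallelogram[OF uL uL, of n k] \<phi>b sum by (simp add: J_def u_def)
    also have "\<dots> \<le> 2 * (\<epsilon> n + \<epsilon> k)"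
      using m_le[OF bT] Ja[of n] Ja[of k] by simp
    finally show ?thesis .
  qed
  have u_diff: "\<bar>l2_inner M (u n) g - l2_inner M (u k) g\<bar> \<le> sqrt (2 * (\<epsilon> n + \<epsilon> k)) * l2_norm M g"
    if g: "g \<in> L2 M" for n k g
  proof -
    have "\<bar>l2_inner M (u n) g - l2_inner M (u k) g\<bar> \<le> l2_norm M (\<lambda>x. u n x - u k x) * l2_norm M g"
      using l2_Cauchy_Schwarz[OF L2_diff[OF uL uL] g, of n k] l2_inner_diff_left[OF uL uL g, of n k]
      by simp
    also have "\<dots> \<le> sqrt (2 * (\<epsilon> n + \<epsilon> k)) * l2_norm M g"
      using u_Cauchy by (intro mult_right_mono real_le_rsqrt) auto
    finally show ?thesis .
  qed
  have conv: "convergent (\<lambda>n. l2_inner M (u n) g)" if g: "g \<in> L2 M" for g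
  proof (rule Cauchy_convergent, rule metric_CauchyI)
    fix e :: real assume e: "e > 0"
    have "(\<lambda>n. sqrt (4 * \<epsilon> n) * l2_norm M g) \<longlonglongrightarrow> sqrt (4 * 0) * l2_norm M g"
      by (intro tendsto_intros \<epsilon>_lim)
    then have "\<forall>\<^sub>F n in sequentially. sqrt (4 * \<epsilon> n) * l2_norm M g < e"
      using e by (simp add: order_tendstoD)
    then obtain N where N: "sqrt (4 * \<epsilon> N) * l2_norm M g < e"
      by (auto simp: eventually_sequentially)
    have "dist (l2_inner M (u n) g) (l2_inner M (u k) g) < e" if "n \<ge> N" "k \<ge> N" for n k
    proof -
      have "\<epsilon> n \<le> \<epsilon> N" "\<epsilon> k \<le> \<epsilon> N"
        using that by (simp_all add: \<epsilon>_def frac_le)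
      then have "sqrt (2 * (\<epsilon> n + \<epsilon> k)) * l2_norm M g \<le> sqrt (4 * \<epsilon> N) * l2_norm M g"
        by (intro mult_right_mono) auto
      with u_diff[OF g, of n k] N show ?thesis by (simp add: dist_real_def)
    qed
    then show "\<exists>N. \<forall>n\<ge>N. \<forall>k\<ge>N. dist (l2_inner M (u n) g) (l2_inner M (u k) g) < e" by blast
  qed
  \<comment> \<open>For \<open>g\<close> outside \<open>L2 M\<close> the value of \<open>lim\<close>
    carries no meaning; \<open>restrict\<close> discards it below.\<close>
  define w where "w g = lim (\<lambda>n. l2_inner M (u n) g)" for g
  have w_lim: "(\<lambda>n. l2_inner M (u n) g) \<longlonglongrightarrow> w g" if "g \<in> L2 M" for g
    unfolding w_def using conv[OF that] by (simp add: convergent_LIMSEQ_iff)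

  have "restrict w (L2 M) \<in> L2_dual M"
  proof (rule L2_dualI)
    fix f g assume fg: "f \<in> L2 M" "g \<in> L2 M"
    have "(\<lambda>n. l2_inner M (u n) f + l2_inner M (u n) g) \<longlonglongrightarrow> w f + w g"
      by (intro tendsto_add w_lim fg)
    then have "(\<lambda>n. l2_inner M (u n) (\<lambda>x. f x + g x)) \<longlonglongrightarrow> w f + w g"
      by (simp add: l2_inner_add_right uL fg)
    then show "w (\<lambda>x. f x + g x) = w f + w g"
      using w_lim[OF L2_add[OF fg]] LIMSEQ_unique by blast
  next
    fix s f assume f: "f \<in> L2 M"
    have "(\<lambda>n. s * l2_inner M (u n) f) \<longlonglongrightarrow> s * w f"
      by (intro tendsto_mult_left w_lim f)
    then have "(\<lambda>n. l2_inner M (u n) (\<lambda>x. s * f x)) \<longlonglongrightarrow> s * w f"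
      by (simp add: l2_inner_scale_right)
    then show "w (\<lambda>x. s * f x) = s * w f"
      using w_lim[OF L2_scale[OF f]] LIMSEQ_unique by blast
  next
    fix f assume f: "f \<in> L2 M"
    \<comment> \<open>A bound uniform in \<open>n\<close> comes from comparing \<open>u n\<close>
      with \<open>u 0\<close>: their distance is at most the square root of
      \<open>2 * (1 + 1)\<close>, that is 2.\<close>
    have "\<bar>l2_inner M (u n) f\<bar> \<le> (l2_norm M (u 0) + 2) * l2_norm M f" for n
    proof -
      have "\<epsilon> n \<le> 1" "\<epsilon> 0 = 1" by (simp_all add: \<epsilon>_def)
      then have "2 * (\<epsilon> n + \<epsilon> 0) \<le> 2\<^sup>2"
        by simp
      then have "sqrt (2 * (\<epsilon> n + \<epsilon> 0)) \<le> 2"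
        by (rule real_le_lsqrt[rotated]) simp
      then have "sqrt (2 * (\<epsilon> n + \<epsilon> 0)) * l2_norm M f \<le> 2 * l2_norm M f"
        by (intro mult_right_mono) auto
      then show ?thesis
        using u_diff[OF f, of n 0] l2_Cauchy_Schwarz[OF uL f, of 0] by (simp add: distrib_right)
    qed
    then show "\<bar>w f\<bar> \<le> (l2_norm M (u 0) + 2) * l2_norm M f"
      using tendsto_rabs[OF w_lim[OF f]] by (intro LIMSEQ_le_const2) auto
  qed
  moreover have "restrict w (L2 M) (A h) = \<phi> h" if h: "h \<in> T" for h
  proof -
    \<comment> \<open>\<open>D n\<close> measures how far \<open>u n\<close> is from representing
      \<open>\<phi>\<close> at \<open>h\<close>. As \<open>J (a n + s *\<^sub>R h)\<close> never
      drops below \<open>m\<close>, a quadratic in \<open>s\<close> with constant term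
      \<open>\<epsilon> n\<close> is nonnegative, and its discriminant forces \<open>D n\<close> to
      0, even when \<open>A h\<close> has seminorm 0.\<close>
    define D where "D n = l2_inner M (u n) (A h) - \<phi> h" for n
    have D: "(D n)\<^sup>2 \<le> (l2_norm M (A h))\<^sup>2 * \<epsilon> n" for n
    proof (rule quadratic_nonneg_imp_discriminant)
      fix s
      have "J (a n + s *\<^sub>R h) = J (a n) + 2 * s * D n + s\<^sup>2 * (l2_norm M (A h))\<^sup>2"
        using l2_norm_add_scale_power2[OF uL AL[OF h], of n s] norm_comb[OF aT h, of n s]
          \<phi>_comb[OF aT h, of n s]
        by (simp add: J_def D_def u_def algebra_simps)
      then show "0 \<le> \<epsilon> n + 2 * s * D n + s\<^sup>2 * (l2_norm M (A h))\<^sup>2"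
        using m_le[OF T_comb[OF aT h], of n s] Ja[of n] by linarith
    qed simp
    have "(\<lambda>n. (D n)\<^sup>2) \<longlonglongrightarrow> 0"
    proof (rule tendsto_sandwich[of "\<lambda>_. 0"])
      show "(\<lambda>n. (l2_norm M (A h))\<^sup>2 * \<epsilon> n) \<longlonglongrightarrow> 0"
        using tendsto_mult_left[OF \<epsilon>_lim] by simp
    qed (use D in simp_all)
    moreover have "(\<lambda>n. (D n)\<^sup>2) \<longlonglongrightarrow> (w (A h) - \<phi> h)\<^sup>2"
      unfolding D_def by (intro tendsto_intros w_lim AL h)
    ultimately have "(w (A h) - \<phi> h)\<^sup>2 = 0"
      using LIMSEQ_unique by blast
    then show ?thesis using AL[OF h] by simp
  qed
  ultimately show thesis by (rule that)
qed

section \<open>Positive information and the range of the adjoint\<close>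

lemma fisher_information_pos_iff:
  "fisher_information T M A \<phi> > 0 \<longleftrightarrow>
    (\<exists>c>0. \<forall>a\<in>T. c * (\<phi> a)\<^sup>2 \<le> (l2_norm M (A a))\<^sup>2)"
proof
  assume "fisher_information T M A \<phi> > 0"
  \<comment> \<open>The information may be infinite, so a real \<open>c\<close> strictly between 0
    and it is chosen.\<close>
  then obtain c where c: "0 < c" "ereal c < fisher_information T M A \<phi>"
    using ereal_dense2[of 0] by auto
  have "c * (\<phi> a)\<^sup>2 \<le> (l2_norm M (A a))\<^sup>2" if "a \<in> T" for a
  proof (cases "\<phi> a = 0")
    case False
    have "fisher_information T M A \<phi> \<le> ereal ((l2_norm M (A a))\<^sup>2 / \<bar>\<phi> a\<bar>\<^sup>2)"
      unfolding fisher_information_def using that False by (intro INF_lower) simp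
    with c(2) have "ereal c < ereal ((l2_norm M (A a))\<^sup>2 / \<bar>\<phi> a\<bar>\<^sup>2)"
      by (rule less_le_trans)
    then show ?thesis using False by (simp add: field_simps)
  qed simp
  with c(1) show "\<exists>c>0. \<forall>a\<in>T. c * (\<phi> a)\<^sup>2 \<le> (l2_norm M (A a))\<^sup>2" by blast
next
  assume "\<exists>c>0. \<forall>a\<in>T. c * (\<phi> a)\<^sup>2 \<le> (l2_norm M (A a))\<^sup>2"
  then obtain c where c: "c > 0" "\<And>a. a \<in> T \<Longrightarrow> c * (\<phi> a)\<^sup>2 \<le> (l2_norm M (A a))\<^sup>2"
    by blast
  \<comment> \<open>This also covers \<open>\<phi>\<close> vanishing on \<open>T\<close>: the
    infimum is then over the empty set, hence infinite.\<close>
  have "ereal c \<le> fisher_information T M A \<phi>"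
    unfolding fisher_information_def using c(2) by (intro INF_greatest) (simp add: field_simps)
  with c(1) show "fisher_information T M A \<phi> > 0"
    by (metis ereal_less(2) less_le_trans)
qed

theorem theorem4p1:
  fixes \<mu> :: "'x measure"
    and \<Lambda> :: "'v::real_normed_vector set"
    and P :: "'v \<Rightarrow> 'x measure"
    and l0 :: 'v
    and A :: "'v \<Rightarrow> 'x \<Rightarrow> real"
    and \<psi> d\<psi> :: "'v \<Rightarrow> real"
  assumes "dominated_model \<mu> \<Lambda> P"
    and "l0 \<in> \<Lambda>"
    and "subspace (tangent_space \<Lambda> l0)"
    and "closed (tangent_space \<Lambda> l0)"
    and "score_operator \<mu> \<Lambda> P l0 A"
    and "path_gradient \<Lambda> l0 \<psi> d\<psi>"
  shows "fisher_information (tangent_space \<Lambda> l0) (P l0) A d\<psi> > 0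
    \<longleftrightarrow> d\<psi> \<in> adjoint_op (tangent_space \<Lambda> l0) A ` L2_dual (P l0)"
proof -
  let ?T = "tangent_space \<Lambda> l0" and ?M = "P l0"
  have A: "continuous_linear_into_L2 ?T ?M A"
    using assms(5) by (simp add: score_operator_def)
  have d\<psi>: "d\<psi> \<in> subspace_dual ?T"
    using assms(6) by (simp add: path_gradient_def)
  show ?thesis
    unfolding fisher_information_pos_iff
  proof
    assume "\<exists>c>0. \<forall>a\<in>?T. c * (d\<psi> a)\<^sup>2 \<le> (l2_norm ?M (A a))\<^sup>2"
    then obtain w where w: "w \<in> L2_dual ?M" "\<And>a. a \<in> ?T \<Longrightarrow> w (A a) = d\<psi> a"
      using functional_factors_through_L2_dual[OF assms(3) A d\<psi>] by blast
    \<comment> \<open>Agreement on the tangent space suffices, since both sides are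
      \<open>undefined\<close> outside it.\<close>
    have "d\<psi> = adjoint_op ?T A w"
      unfolding adjoint_op_def
      by (rule extensionalityI[of _ ?T]) (use d\<psi> w(2) in \<open>auto simp: subspace_dual_def\<close>)
    with w(1) show "d\<psi> \<in> adjoint_op ?T A ` L2_dual ?M" by blast
  next
    assume "d\<psi> \<in> adjoint_op ?T A ` L2_dual ?M"
    then obtain w where w: "w \<in> L2_dual ?M" "d\<psi> = adjoint_op ?T A w" by blast
    from w(1) obtain d where d: "d > 0" "\<And>f. f \<in> L2 ?M \<Longrightarrow> d * \<bar>w f\<bar> \<le> l2_norm ?M f"
      by (rule L2_dual_bounded) blast
    \<comment> \<open>Squaring the linear bound from continuity of \<open>w\<close> turns its
      constant \<open>d\<close> into the lower bound \<open>d\<^sup>2\<close> for the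
      information.\<close>
    have "d\<^sup>2 * (d\<psi> a)\<^sup>2 \<le> (l2_norm ?M (A a))\<^sup>2" if a: "a \<in> ?T" for a
    proof -
      have "A a \<in> L2 ?M"
        using A a by (simp add: continuous_linear_into_L2_def)
      then have "d * \<bar>d\<psi> a\<bar> \<le> l2_norm ?M (A a)"
        using d(2) a by (simp add: w(2) adjoint_op_def)
      then have "(d * \<bar>d\<psi> a\<bar>)\<^sup>2 \<le> (l2_norm ?M (A a))\<^sup>2"
        using d(1) by (intro power_mono) auto
      then show ?thesis by (simp add: power_mult_distrib)
    qed
    then show "\<exists>c>0. \<forall>a\<in>?T. c * (d\<psi> a)\<^sup>2 \<le> (l2_norm ?M (A a))\<^sup>2"
      using d(1) by (intro exI[of _ "d\<^sup>2"]) auto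
  qed
qed

end
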